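(* Let $k,\ell\ge 1$ be integers and let $\lambda\in H(k,\ell)$ be a $(k,\ell)$-hook partition. Then the supersymmetric Schur polynomial $S_\lambda(x,y)=S_\lambda(x_1,\dots,x_k,y_1,\dots,y_\ell)$ has a saturated Newton polytope; that is, $\operatorname{Newton}(S_\lambda)\cap\mathbb{Z}^{k+\ell}=\operatorname{Supp}(S_\lambda)$.
   Context: Conventions: $\mathbb{N}=\{0,1,2,\dots\}$. For a polynomial $f=\sum_{\alpha\in\mathbb{N}^d}c_\alpha \mathbf{z}^\alpha$ in $d$ variables, $\operatorname{Supp}(f)=\{\alpha : c_\alpha\ne 0\}$ and $\operatorname{Newton}(f)=\operatorname{Conv}(\operatorname{Supp}(f))\subset\mathbb{R}^d$ (convex hull). A partition $\lambda=(\lambda_1\ge\lambda_2\ge\cdots)$ (padded by zeros) lies in the hook $H(k,\ell)$ if $\lambda_{k+1}\le\ell$. Consider the ordered alphabet $t_1<t_2<\dots<t_k<u_1<u_2<\dots<u_\ell$. A $(k,\ell)$-semistandard tableau of shape $\lambda$ is a filling $T$ of the Young diagram of $\lambda$ with these letters such that: the entries are weakly increasing (with respect to the order $t_1<t_2<\dots<t_k<u_1<u_2<\dots<u_\ell$) along rows from left to right and down columns; the $t$-letters are weakly increasing along rows and strictly increasing down columns; the $u$-letters are weakly increasing down columns and strictly increasing along rows. Let $\operatorname{SSYT}_{k,\ell}(\lambda)$ be the set of these tableaux. For such $T$, let $a_i(T)$ be the number of entries equal to $t_i$ and $b_j(T)$ the number of entries equal to $u_j$. The supersymmetric Schur polynomial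 of shape $\lambda\in H(k,\ell)$ in $x=(x_1,\dots,x_k)$, $y=(y_1,\dots,y_\ell)$ is $$S_\lambda(x,y)=\sum_{T\in\operatorname{SSYT}_{k,\ell}(\lambda)}x_1^{a_1(T)}\cdots x_k^{a_k(T)}\,y_1^{b_1(T)}\cdots y_\ell^{b_\ell(T)}.$$ Exponent vectors are written $(\mathbf{a},\mathbf{b})\in\mathbb{N}^k\times\mathbb{N}^\ell=\mathbb{N}^{k+\ell}$. *)

theory Defs
  imports "HOL-Analysis.Finite_Function_Topology" "HOL-Analysis.Analysis"
begin

text \<open>A polynomial in the variables \<open>z\<^sub>0, z\<^sub>1, \<dots>\<close> is a finitely supported map from exponent vectors
  to coefficients. Polynomials in \<open>d\<close> variables use only \<open>z\<^sub>0, \<dots>, z\<^sub>d\<^sub>-\<^sub>1\<close>, and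
  \<open>\<real>\<^sup>d\<close> is the subspace of \<^typ>\<open>nat \<Rightarrow>\<^sub>0 real\<close> of vectors supported on \<^term>\<open>{..<d}\<close>.\<close>

type_synonym 'a mpoly = "(nat \<Rightarrow>\<^sub>0 nat) \<Rightarrow>\<^sub>0 'a"

definition Var :: "nat \<Rightarrow> 'a::comm_semiring_1 mpoly" where
  "Var i = Poly_Mapping.single (Poly_Mapping.single i 1) 1"

definition Supp :: "'a::zero mpoly \<Rightarrow> (nat \<Rightarrow>\<^sub>0 real) set" where
  "Supp f = Poly_Mapping.map real ` Poly_Mapping.keys f"

definition Newton :: "'a::zero mpoly \<Rightarrow> (nat \<Rightarrow>\<^sub>0 real) set" where
  "Newton f = convex hull (Supp f)"

definition integer_lattice :: "nat \<Rightarrow> (nat \<Rightarrow>\<^sub>0 real) set" where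
  "integer_lattice d =
     {p. Poly_Mapping.keys p \<subseteq> {..<d} \<and> (\<forall>i<d. Poly_Mapping.lookup p i \<in> \<int>)}"

definition saturated_Newton_polytope :: "nat \<Rightarrow> 'a::zero mpoly \<Rightarrow> bool" where
  "saturated_Newton_polytope d f \<longleftrightarrow> Newton f \<inter> integer_lattice d = Supp f"

text \<open>Rows, columns and parts of partitions are numbered from \<open>0\<close>; so \<open>\<lambda>\<^sub>i\<^sub>+\<^sub>1\<close> is \<open>lam i\<close>.\<close>

definition is_partition :: "(nat \<Rightarrow> nat) \<Rightarrow> bool" where
  "is_partition lam \<longleftrightarrow> antimono lam \<and> finite {i. lam i \<noteq> 0}"

definition hook :: "nat \<Rightarrow> nat \<Rightarrow> (nat \<Rightarrow> nat) set" where
  "hook k l = {lam. is_partition lam \<and> lam k \<le> l}"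

definition young_diagram :: "(nat \<Rightarrow> nat) \<Rightarrow> (nat \<times> nat) set" where
  "young_diagram lam = {(i, j). j < lam i}"

text \<open>The alphabet \<open>t\<^sub>1 < \<dots> < t\<^sub>k < u\<^sub>1 < \<dots> < u\<^sub>l\<close> is encoded as \<open>{..<k + l}\<close> with the usual order:
  \<open>t\<^sub>i\<^sub>+\<^sub>1\<close> is \<open>i\<close> for \<open>i < k\<close>, and \<open>u\<^sub>j\<^sub>+\<^sub>1\<close> is \<open>k + j\<close> for \<open>j < l\<close>. A filling is \<open>undefined\<close> outside
  the diagram, so that equal fillings are equal as functions.\<close>

definition SSYT :: "nat \<Rightarrow> nat \<Rightarrow> (nat \<Rightarrow> nat) \<Rightarrow> (nat \<times> nat \<Rightarrow> nat) set" where
  "SSYT k l lam =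
     {T \<in> young_diagram lam \<rightarrow>\<^sub>E {..<k + l}.
        (\<forall>i j j'. (i, j) \<in> young_diagram lam \<and> (i, j') \<in> young_diagram lam \<and> j < j' \<longrightarrow>
           T (i, j) \<le> T (i, j') \<and>
           (k \<le> T (i, j) \<and> k \<le> T (i, j') \<longrightarrow> T (i, j) < T (i, j'))) \<and>
        (\<forall>i i' j. (i, j) \<in> young_diagram lam \<and> (i', j) \<in> young_diagram lam \<and> i < i' \<longrightarrow>
           T (i, j) \<le> T (i', j) \<and>
           (T (i, j) < k \<and> T (i', j) < k \<longrightarrow> T (i, j) < T (i', j)))}"

definition multiplicity_in :: "(nat \<Rightarrow> nat) \<Rightarrow> (nat \<times> nat \<Rightarrow> nat) \<Rightarrow> nat \<Rightarrow> nat" where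
  "multiplicity_in lam T v = card {c \<in> young_diagram lam. T c = v}"

text \<open>The variables \<open>x\<^sub>i\<^sub>+\<^sub>1\<close> and \<open>y\<^sub>j\<^sub>+\<^sub>1\<close> are \<^term>\<open>Var i\<close> and \<^term>\<open>Var (k + j)\<close>.\<close>

definition super_schur :: "nat \<Rightarrow> nat \<Rightarrow> (nat \<Rightarrow> nat) \<Rightarrow> int mpoly" where
  "super_schur k l lam =
     (\<Sum>T\<in>SSYT k l lam.
        (\<Prod>i<k. Var i ^ multiplicity_in lam T i) *
        (\<Prod>j<l. Var (k + j) ^ multiplicity_in lam T (k + j)))"

lemma finite_young_diagram:
  assumes "is_partition lam"
  shows "finite (young_diagram lam)"
proof -
  have "young_diagram lam = (SIGMA i:{i. lam i \<noteq> 0}. {..<lam i})"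
    by (auto simp: young_diagram_def)
  with assms show ?thesis
    by (simp add: is_partition_def)
qed

text \<open>In particular the sum defining \<^const>\<open>super_schur\<close> is a finite one.\<close>

lemma finite_SSYT:
  assumes "is_partition lam"
  shows "finite (SSYT k l lam)"
proof (rule finite_subset)
  show "SSYT k l lam \<subseteq> young_diagram lam \<rightarrow>\<^sub>E {..<k + l}"
    by (auto simp: SSYT_def)
  show "finite (young_diagram lam \<rightarrow>\<^sub>E {..<k + l})"
    by (rule finite_PiE) (simp_all add: finite_young_diagram assms)
qed

end

theory Submission
  imports Defs
begin

text \<open>
  Write \<open>f(i, j)\<close> for the number of cells of the diagram of \<open>lam\<close> that lie in the first \<open>i\<close> rows or in
  the first \<open>j\<close> columns. The support of the supersymmetric Schur polynomial is the set of all lattice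
  points \<open>(a, b)\<close> with nonnegative coordinates and coordinate sum \<open>|lam|\<close> such that
  \<open>a(I) + b(J) \<le> f(|I|, |J|)\<close> for all sets \<open>I\<close> of \<open>t\<close>-letters and \<open>J\<close> of \<open>u\<close>-letters. These conditions
  are linear and hence pass from the support to its convex hull, so each lattice point of the Newton
  polytope satisfies them and is therefore in the support.

  That contents of tableaux satisfy the inequalities is shown by adding the letters one by one: when a
  selected \<open>u\<close>-letter is added, its cells, at most one per row, can be injected into the cells that
  the growing hook region gains, and dually for \<open>t\<close>-letters (\<open>card_letters_le_hook_cells\<close>).

  Conversely, given \<open>(a, b)\<close>, the main problem is to find the shape \<open>mu\<close> of the part of the tableau
  that holds the \<open>t\<close>-letters. With \<open>A\<^sub>i\<close> the largest value of \<open>a(I)\<close> for \<open>|I| = i\<close>, the requirements are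
  that \<open>mu\<close> dominates \<open>A\<close>, which makes \<open>a\<close> a possible content of \<open>mu\<close>, and that the row lengths of
  \<open>lam/mu\<close> are the row sums of a \<open>0/1\<close> matrix with column sums \<open>b\<close>, which makes \<open>b\<close> a possible content
  of \<open>lam/mu\<close> in \<open>u\<close>-letters. Without the condition that \<open>mu\<close> decreases, this is a transportation
  problem: the letter \<open>u\<^sub>j\<close> supplies at most one unit to each row, and an auxiliary source with supply
  \<open>A\<^sub>r\<^sub>+\<^sub>1 - A\<^sub>r\<close> serves the rows up to \<open>r\<close>. Its cut conditions are the inequalities above
  (\<open>exists_admissible_matrix\<close>, from \<open>transport_feasible\<close>). Pushing the units of the matrix to as low
  rows as possible makes \<open>mu\<close> a partition (\<open>exists_admissible_matrix_partition\<close>). Finally a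
  \<open>0/1\<close> matrix is turned into a filling by peeling off vertical strips
  (\<open>exists_row_strict_filling\<close>); the same statement for the conjugate of \<open>mu\<close> fills \<open>mu\<close> with
  \<open>t\<close>-letters.
\<close>

section \<open>Integral transportation plans\<close>

lemma sum_fun_upd_minus_one:
  fixes f :: "'a \<Rightarrow> nat"
  assumes "finite S" "f a > 0"
  shows "sum f S = sum (f(a := f a - 1)) S + of_bool (a \<in> S)"
proof (cases "a \<in> S")
  case True
  then have "sum f S = f a + sum f (S - {a})"
    "sum (f(a := f a - 1)) S = (f a - 1) + sum (f(a := f a - 1)) (S - {a})"
    using assms(1) by (simp_all add: sum.remove)
  moreover have "sum (f(a := f a - 1)) (S - {a}) = sum f (S - {a})"
    by (rule sum.cong) auto
  ultimately show ?thesis using True assms(2) by simp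
next
  case False
  then show ?thesis by (auto intro!: sum.cong)
qed

text \<open>The capacity of a cut is submodular, and the two uncrossed cuts lose every edge from \<open>X - X'\<close> to
  \<open>Y' - Y\<close>. In the proof below one such edge makes the inequality strict.\<close>

lemma cut_uncrossing:
  fixes c :: "'a \<times> 'b \<Rightarrow> nat"
  assumes fin: "finite X" "finite X'" "finite B"
    and x: "x \<in> X" "x \<notin> X'" and y: "y \<in> B" "y \<notin> Y" "y \<in> Y'"
  shows "sum c ((X \<union> X') \<times> (B - (Y \<union> Y'))) + sum c ((X \<inter> X') \<times> (B - (Y \<inter> Y'))) + c (x, y)
    \<le> sum c (X \<times> (B - Y)) + sum c (X' \<times> (B - Y'))"
proof -
  let ?E = "X \<times> (B - Y)" and ?E' = "X' \<times> (B - Y')"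
  let ?U = "(X \<union> X') \<times> (B - (Y \<union> Y'))" and ?I = "(X \<inter> X') \<times> (B - (Y \<inter> Y'))"
  have f: "finite ?E" "finite ?E'" "finite ?U" "finite ?I" using fin by auto
  have "sum c ?U + sum c ?I + c (x, y) = sum c (insert (x, y) (?U \<union> ?I)) + sum c (?U \<inter> ?I)"
  proof -
    have "(x, y) \<notin> ?U \<union> ?I" using x y by blast
    then have "sum c (insert (x, y) (?U \<union> ?I)) = c (x, y) + sum c (?U \<union> ?I)"
      using f by (intro sum.insert) auto
    then show ?thesis using sum.union_inter[OF f(3,4), of c] by linarith
  qed
  also have "\<dots> \<le> sum c (?E \<union> ?E') + sum c (?E \<inter> ?E')"
  proof (intro add_mono sum_mono2)
    show "insert (x, y) (?U \<union> ?I) \<subseteq> ?E \<union> ?E'" using x y by blast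
    show "?U \<inter> ?I \<subseteq> ?E \<inter> ?E'" by blast
  qed (use f in simp_all)
  also have "\<dots> = sum c ?E + sum c ?E'"
    using f(1,2) by (rule sum.union_inter)
  finally show ?thesis .
qed

definition transport_plan :: "'a set \<Rightarrow> 'b set \<Rightarrow> ('a \<Rightarrow> nat) \<Rightarrow> ('b \<Rightarrow> nat) \<Rightarrow> ('a \<times> 'b \<Rightarrow> nat)
    \<Rightarrow> ('a \<times> 'b \<Rightarrow> nat) \<Rightarrow> bool" where
  "transport_plan A B p q c N \<longleftrightarrow> (\<forall>e. N e \<le> c e) \<and> (\<forall>x\<in>A. (\<Sum>y\<in>B. N (x, y)) = p x)
    \<and> (\<forall>y\<in>B. (\<Sum>x\<in>A. N (x, y)) = q y)"

lemma transport_planD: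
  assumes "transport_plan A B p q c N"
  shows "N e \<le> c e" "x \<in> A \<Longrightarrow> (\<Sum>y\<in>B. N (x, y)) = p x"
    "y \<in> B \<Longrightarrow> (\<Sum>x\<in>A. N (x, y)) = q y"
  using assms unfolding transport_plan_def by blast+

text \<open>Each step of the induction picks an edge with positive capacity and either lowers its capacity by
  one or also sends one unit along it. If lowering the capacity violates the cut condition, then
  some tight cut \<open>(X, Y)\<close> is crossed by the edge. If sending a unit violates it too, then a second tight
  cut \<open>(X', Y')\<close> separates the ends of the edge the other way round, and uncrossing the two
  cuts gives one that violates the cut condition.\<close>

theorem transport_feasible:
  fixes p :: "'a \<Rightarrow> nat" and q :: "'b \<Rightarrow> nat" and c :: "'a \<times> 'b \<Rightarrow> nat"
  assumes "finite A" "finite B" "sum p A = sum q B"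
    and "\<And>X Y. X \<subseteq> A \<Longrightarrow> Y \<subseteq> B \<Longrightarrow> sum p X \<le> sum q Y + sum c (X \<times> (B - Y))"
  shows "\<exists>N. transport_plan A B p q c N"
  using assms(3,4)
proof (induction "sum c (A \<times> B)" arbitrary: c p q rule: less_induct)
  case less
  note fin = assms(1,2)
  note total = less.prems(1) and cond = less.prems(2)
  show ?case
  proof (cases "\<exists>e \<in> A \<times> B. c e > 0")
    case False
    then have "sum c (A \<times> B) = 0" by (intro sum.neutral) auto
    with cond[of A "{}"] have "sum p A = 0" by simp
    moreover from this have "sum q B = 0" using total by simp
    ultimately show ?thesis using fin by (intro exI[of _ "\<lambda>_. 0"]) (simp add: transport_plan_def)
  next
    case True
    then obtain x y where xy: "x \<in> A" "y \<in> B" and pos: "c (x, y) > 0" by auto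
    let ?c = "c((x, y) := c (x, y) - 1)"
    have finX: "finite X" if "X \<subseteq> A" for X using that fin finite_subset by blast
    have finY: "finite Y" if "Y \<subseteq> B" for Y using that fin finite_subset by blast
    have dec: "sum c (X \<times> (B - Y)) = sum ?c (X \<times> (B - Y)) + of_bool (x \<in> X \<and> y \<notin> Y)"
      if "X \<subseteq> A" for X Y
      using sum_fun_upd_minus_one[of "X \<times> (B - Y)" c, OF _ pos] finX[OF that] fin xy by simp
    have less_c: "sum ?c (A \<times> B) < sum c (A \<times> B)" using dec[of A "{}"] xy by simp
    show ?thesis
    proof (cases "\<forall>X Y. X \<subseteq> A \<longrightarrow> Y \<subseteq> B \<longrightarrow> sum p X \<le> sum q Y + sum ?c (X \<times> (B - Y))")
      case True
      have "\<exists>N. transport_plan A B p q ?c N"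
        by (rule less.hyps[OF less_c total]) (use True in simp)
      then obtain N where N: "transport_plan A B p q ?c N" by (rule exE)
      then have "\<forall>e. N e \<le> ?c e" by (simp add: transport_plan_def)
      moreover have "?c e \<le> c e" for e by simp
      ultimately have "\<forall>e. N e \<le> c e" using le_trans by blast
      with N show ?thesis by (intro exI[of _ N]) (simp add: transport_plan_def)
    next
      case False
      then obtain X Y where XY: "X \<subseteq> A" "Y \<subseteq> B" "sum q Y + sum ?c (X \<times> (B - Y)) < sum p X"
        by (meson not_le)
      then have in1: "x \<in> X" "y \<notin> Y" and
        tight1: "sum p X = sum q Y + sum c (X \<times> (B - Y))"
        using dec[OF XY(1), of Y] cond[OF XY(1,2)] by (simp_all add: of_bool_def split: if_splits)
      \<comment> \<open>With no supply at \<open>x\<close>, or no demand at \<open>y\<close>, the tight cut could be made cheaper by moving that vertex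
        to the other side.\<close>
      have px: "p x > 0"
      proof (rule ccontr)
        assume "\<not> p x > 0"
        then have "sum p (X - {x}) = sum p X" using in1 finX[OF XY(1)] by (simp add: sum.remove)
        moreover have "sum c ((X - {x}) \<times> (B - Y)) + c (x, y) \<le> sum c (X \<times> (B - Y))"
        proof -
          have "sum c ((X - {x}) \<times> (B - Y)) + c (x, y) = sum c (insert (x, y) ((X - {x}) \<times> (B - Y)))"
            using finX[OF XY(1)] fin by (subst sum.insert) auto
          also have "\<dots> \<le> sum c (X \<times> (B - Y))"
            using finX[OF XY(1)] fin in1 xy by (intro sum_mono2) auto
          finally show ?thesis .
        qed
        moreover have "sum p (X - {x}) \<le> sum q Y + sum c ((X - {x}) \<times> (B - Y))"
          using XY by (intro cond) auto
        ultimately show False using tight1 pos by linarith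
      qed
      have qy: "q y > 0"
      proof (rule ccontr)
        assume "\<not> q y > 0"
        then have "sum q (insert y Y) = sum q Y" using in1 finY[OF XY(2)] by simp
        moreover have "sum c (X \<times> (B - insert y Y)) + c (x, y) \<le> sum c (X \<times> (B - Y))"
        proof -
          have "sum c (X \<times> (B - insert y Y)) + c (x, y) = sum c (insert (x, y) (X \<times> (B - insert y Y)))"
            using finX[OF XY(1)] fin by (subst sum.insert) auto
          also have "\<dots> \<le> sum c (X \<times> (B - Y))"
            using finX[OF XY(1)] fin in1 xy by (intro sum_mono2) auto
          finally show ?thesis .
        qed
        moreover have "sum p X \<le> sum q (insert y Y) + sum c (X \<times> (B - insert y Y))"
          using XY xy by (intro cond) auto
        ultimately show False using tight1 pos by linarith
      qed
      let ?p = "p(x := p x - 1)" and ?q = "q(y := q y - 1)"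
      have decp: "sum p X = sum ?p X + of_bool (x \<in> X)" if "X \<subseteq> A" for X
        using sum_fun_upd_minus_one[of X p x] px finX[OF that] by simp
      have decq: "sum q Y = sum ?q Y + of_bool (y \<in> Y)" if "Y \<subseteq> B" for Y
        using sum_fun_upd_minus_one[of Y q y] qy finY[OF that] by simp
      have "sum ?p A = sum ?q B" using decp[of A] decq[of B] total xy by simp
      moreover have "sum ?p X' \<le> sum ?q Y' + sum ?c (X' \<times> (B - Y'))"
        if sub: "X' \<subseteq> A" "Y' \<subseteq> B" for X' Y'
      proof (rule ccontr)
        assume "\<not> ?thesis"
        then have in2: "x \<notin> X'" "y \<in> Y'" and tight2: "sum p X' = sum q Y' + sum c (X' \<times> (B - Y'))"
          using decp[OF sub(1)] decq[OF sub(2)] dec[OF sub(1), of Y'] cond[OF sub]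
          by (simp_all add: of_bool_def split: if_splits)
        have "sum p (X \<union> X') + sum p (X \<inter> X') = sum p X + sum p X'"
          using sub XY finX by (simp add: sum.union_inter)
        moreover have "sum q (Y \<union> Y') + sum q (Y \<inter> Y') = sum q Y + sum q Y'"
          using sub XY finY by (simp add: sum.union_inter)
        moreover have "sum p (X \<union> X') \<le> sum q (Y \<union> Y') + sum c ((X \<union> X') \<times> (B - (Y \<union> Y')))"
          using cond sub XY by simp
        moreover have "sum p (X \<inter> X') \<le> sum q (Y \<inter> Y') + sum c ((X \<inter> X') \<times> (B - (Y \<inter> Y')))"
          using cond[of "X \<inter> X'" "Y \<inter> Y'"] sub XY by blast
        moreover have "sum c ((X \<union> X') \<times> (B - (Y \<union> Y'))) + sum c ((X \<inter> X') \<times> (B - (Y \<inter> Y'))) + c (x, y)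
            \<le> sum c (X \<times> (B - Y)) + sum c (X' \<times> (B - Y'))"
          using finX[OF XY(1)] finX[OF sub(1)] fin(2) in1(1) in2(1) xy(2) in1(2) in2(2)
          by (rule cut_uncrossing)
        ultimately show False using tight1 tight2 pos by linarith
      qed
      ultimately have "\<exists>N. transport_plan A B ?p ?q ?c N"
        by (rule less.hyps[OF less_c])
      then obtain N where plan: "transport_plan A B ?p ?q ?c N" by (rule exE)
      have N: "\<forall>e. N e \<le> ?c e" "\<forall>x'\<in>A. (\<Sum>y\<in>B. N (x', y)) = ?p x'"
        "\<forall>y'\<in>B. (\<Sum>x\<in>A. N (x, y')) = ?q y'"
        using transport_planD[OF plan] by blast+
      let ?N = "N((x, y) := Suc (N (x, y)))"
      have "?N e \<le> c e" for e
        using N(1)[rule_format, of e] pos by (auto split: if_splits)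
      moreover have "(\<Sum>y'\<in>B. ?N (x', y')) = p x'" if "x' \<in> A" for x'
      proof (cases "x' = x")
        case True
        have "(\<Sum>y'\<in>B. ?N (x, y')) = (\<Sum>y'\<in>B. N (x, y') + of_bool (y' = y))"
          by (rule sum.cong) auto
        then show ?thesis using N(2)[rule_format, OF xy(1)] True px fin xy by (simp add: sum.distrib of_bool_def sum.delta)
      next
        case False
        then show ?thesis using N(2) that by simp
      qed
      moreover have "(\<Sum>x'\<in>A. ?N (x', y')) = q y'" if "y' \<in> B" for y'
      proof (cases "y' = y")
        case True
        have "(\<Sum>x'\<in>A. ?N (x', y)) = (\<Sum>x'\<in>A. N (x', y) + of_bool (x' = x))"
          by (rule sum.cong) auto
        then show ?thesis using N(3)[rule_format, OF xy(2)] True qy fin xy by (simp add: sum.distrib of_bool_def sum.delta)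
      next
        case False
        then show ?thesis using N(3) that by simp
      qed
      ultimately show ?thesis by (intro exI[of _ ?N]) (simp add: transport_plan_def)
    qed
  qed
qed

section \<open>Row-strict fillings of skew shapes\<close>

lemma sum_transpose_lessThan:
  assumes "Suc r < n"
  shows "(\<Sum>i<n. g (Transposition.transpose r (Suc r) i)) = (\<Sum>i<n. g i)"
proof -
  have "Transposition.transpose r (Suc r) permutes {..<n}"
    using assms by (intro permutes_swap_id) auto
  from sum.permute[OF this, of g] show ?thesis by (simp add: comp_def)
qed

text \<open>The weight \<open>\<Sum>i. i * g i\<close> is the potential that strictly increases when a one moves down by a row;
  matrices that maximise it are used twice below.\<close>

lemma weighted_sum_transpose:
  fixes g :: "nat \<Rightarrow> nat"
  assumes "Suc r < n" "g r = 1" "g (Suc r) = 0"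
  shows "(\<Sum>i<n. i * g (Transposition.transpose r (Suc r) i)) = Suc (\<Sum>i<n. i * g i)"
proof -
  have "(\<Sum>i<n. i * g (Transposition.transpose r (Suc r) i))
      = (\<Sum>i<n. Transposition.transpose r (Suc r) (Transposition.transpose r (Suc r) i) * g (Transposition.transpose r (Suc r) i))"
    by simp
  also have "\<dots> = (\<Sum>i<n. Transposition.transpose r (Suc r) i * g i)"
    using sum_transpose_lessThan[OF assms(1), of "\<lambda>i. Transposition.transpose r (Suc r) i * g i"] .
  also have "\<dots> = (\<Sum>i<n. i * g i + of_bool (i = r))"
    using assms(2,3) by (intro sum.cong) (auto simp: Transposition.transpose_def)
  finally show ?thesis using assms(1) by (simp add: sum.distrib of_bool_def)
qed

lemma prefix_sum_transpose:
  fixes g :: "nat \<Rightarrow> nat"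
  assumes "g r = 1" "g (Suc r) = 0"
  shows "(\<Sum>i<m. g (Transposition.transpose r (Suc r) i)) \<le> (\<Sum>i<m. g i)"
proof (cases "Suc r < m")
  case True
  then show ?thesis by (simp add: sum_transpose_lessThan)
next
  case False
  have "g (Transposition.transpose r (Suc r) i) \<le> g i" if "i < m" for i
    using that False assms by (auto simp: Transposition.transpose_def)
  then show ?thesis by (intro sum_mono) simp
qed

text \<open>A nonzero entry \<open>M j r\<close> announces that row \<open>r\<close> of the skew shape \<open>lam/mu\<close> holds the letter \<open>j\<close>,
  without saying in which cell.\<close>

definition strip_matrix :: "nat \<Rightarrow> nat \<Rightarrow> (nat \<Rightarrow> nat) \<Rightarrow> (nat \<Rightarrow> nat) \<Rightarrow> (nat \<Rightarrow> nat)
    \<Rightarrow> (nat \<Rightarrow> nat \<Rightarrow> nat) \<Rightarrow> bool" where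
  "strip_matrix l n lam mu b M \<longleftrightarrow> (\<forall>j r. M j r \<le> 1) \<and> (\<forall>r. mu r + (\<Sum>j<l. M j r) = lam r)
    \<and> (\<forall>j<l. (\<Sum>r<n. M j r) = b j)"

text \<open>Among all matrices with the given margins, take one whose ones in the last column \<open>l\<close> are as low as
  possible. If removing them from \<open>lam\<close> did not leave a partition, there would be equal rows \<open>r\<close> and
  \<open>r + 1\<close> with a one only in row \<open>r\<close>. Since \<open>mu\<close> decreases, row \<open>r + 1\<close> of the skew shape is at least as
  long as row \<open>r\<close>, so in some other column \<open>j\<close> only row \<open>r + 1\<close> has a one, and exchanging the two rows in
  the columns \<open>j\<close> and \<open>l\<close> keeps all margins but lowers a one of column \<open>l\<close>.\<close>

lemma exists_strip_matrix_removing_strip: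
  assumes M: "strip_matrix (Suc l) n lam mu b M"
    and lam: "antimono lam" "\<And>r. r \<ge> n \<Longrightarrow> lam r = 0" and mu: "antimono mu"
  shows "\<exists>M. strip_matrix (Suc l) n lam mu b M \<and> antimono (\<lambda>r. lam r - M l r)"
proof -
  let ?P = "strip_matrix (Suc l) n lam mu b" and ?w = "\<lambda>M :: nat \<Rightarrow> nat \<Rightarrow> nat. \<Sum>r<n. r * M l r"
  have "?w M < Suc (\<Sum>r<n. r)" if "?P M" for M
    using that by (intro le_imp_less_Suc sum_mono) (auto simp: strip_matrix_def)
  then have "\<exists>M. ?P M \<and> (\<forall>M'. ?P M' \<longrightarrow> ?w M' \<le> ?w M)"
    using M by (intro ex_has_greatest_nat[of ?P M ?w "Suc (\<Sum>r<n. r)"]) auto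
  then obtain M where max: "?P M \<and> (\<forall>M'. ?P M' \<longrightarrow> ?w M' \<le> ?w M)"
    by (rule exE)
  have M: "?P M" using max by (rule conjunct1)
  have opt: "?w M' \<le> ?w M" if "?P M'" for M'
    using conjunct2[OF max, rule_format, OF that] .
  have le1: "M j r \<le> 1" for j r using M by (auto simp: strip_matrix_def)
  have row: "mu r + (\<Sum>j<l. M j r) + M l r = lam r" for r
    using M by (auto simp: strip_matrix_def add.assoc)
  have "lam (Suc r) - M l (Suc r) \<le> lam r - M l r" for r
  proof (rule ccontr)
    assume "\<not> ?thesis"
    then have *: "lam r = lam (Suc r)" "M l r = 1" "M l (Suc r) = 0"
      using antimonoD[OF lam(1), of r "Suc r"] le1[of l r] le1[of l "Suc r"] by auto
    have rn: "Suc r < n"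
      using *(1,2) lam(2)[of "Suc r"] row[of r] by (cases "Suc r < n") auto
    have "(\<Sum>j<l. M j r) < (\<Sum>j<l. M j (Suc r))"
      using row[of r] row[of "Suc r"] antimonoD[OF mu, of r "Suc r"] * by linarith
    then obtain j where j: "j < l" "M j r < M j (Suc r)"
      by (meson lessThan_iff not_le sum_mono)
    then have jv: "M j r = 0" "M j (Suc r) = 1" using le1[of j "Suc r"] by auto
    let ?M = "\<lambda>j' r'. if j' = j \<or> j' = l then M j' (Transposition.transpose r (Suc r) r') else M j' r'"
    have "?P ?M"
      unfolding strip_matrix_def
    proof (intro conjI allI impI)
      fix j' r' show "?M j' r' \<le> 1" using le1 by auto
    next
      fix j' assume "j' < Suc l"
      moreover have "(\<Sum>r'<n. ?M j' r') = (\<Sum>r'<n. M j' r')"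
        using sum_transpose_lessThan[OF rn, of "M j'"] by (cases "j' = j \<or> j' = l") simp_all
      ultimately show "(\<Sum>r'<n. ?M j' r') = b j'" using M by (simp add: strip_matrix_def)
    next
      fix r'
      have split: "(\<Sum>j'<Suc l. f j') = (\<Sum>j'\<in>{..<l}-{j}. f j') + f j + f l" for f :: "nat \<Rightarrow> nat"
        using j(1) by (simp add: sum.remove[of "{..<l}" j])
      have "(\<Sum>j'<Suc l. ?M j' r') = (\<Sum>j'<Suc l. M j' r')"
        unfolding split using j(1) jv * by (auto simp: Transposition.transpose_def intro!: sum.cong)
      then show "mu r' + (\<Sum>j'<Suc l. ?M j' r') = lam r'"
        using M by (simp add: strip_matrix_def del: sum.lessThan_Suc)
    qed
    then have "?w ?M \<le> ?w M" by (rule opt)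
    then show False using weighted_sum_transpose[of r n "M l"] rn * by simp
  qed
  then have "antimono (\<lambda>r. lam r - M l r)" by (rule antimono_iff_le_Suc[THEN iffD2, OF allI])
  with M show ?thesis by blast
qed

definition skew_diagram :: "(nat \<Rightarrow> nat) \<Rightarrow> (nat \<Rightarrow> nat) \<Rightarrow> (nat \<times> nat) set" where
  "skew_diagram lam mu = {(r, c). mu r \<le> c \<and> c < lam r}"

definition row_strict_filling ::
    "nat \<Rightarrow> (nat \<Rightarrow> nat) \<Rightarrow> (nat \<Rightarrow> nat) \<Rightarrow> (nat \<Rightarrow> nat) \<Rightarrow> (nat \<times> nat \<Rightarrow> nat) \<Rightarrow> bool" where
  "row_strict_filling l lam mu b T \<longleftrightarrow>
    (\<forall>e\<in>skew_diagram lam mu. T e < l)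
    \<and> (\<forall>r c c'. mu r \<le> c \<and> c < c' \<and> c' < lam r \<longrightarrow> T (r, c) < T (r, c'))
    \<and> (\<forall>r r' c. mu r \<le> c \<and> r < r' \<and> c < lam r' \<longrightarrow> T (r, c) \<le> T (r', c))
    \<and> (\<forall>j<l. card {e\<in>skew_diagram lam mu. T e = j} = b j)"

text \<open>The cells of the largest letter are the row ends given by the last column of the matrix, chosen
  such that the remaining shape is a partition; the rest is filled by induction.\<close>

lemma exists_row_strict_filling:
  assumes "strip_matrix l n lam mu b M" "antimono lam" "antimono mu" "\<forall>r\<ge>n. lam r = 0"
  shows "\<exists>T. row_strict_filling l lam mu b T"
  using assms
proof (induction l arbitrary: lam M)
  case 0
  then have "mu r = lam r" for r by (simp add: strip_matrix_def)
  then have "mu = lam" by blast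
  moreover have "lam r' \<le> lam r" if "r < r'" for r r'
    using antimonoD[OF 0(2), of r r'] that by simp
  ultimately show ?case
    by (auto simp: row_strict_filling_def skew_diagram_def dest: leD order_less_le_trans)
next
  case (Suc l)
  note lam = Suc.prems(2) and mu = Suc.prems(3) and zero = Suc.prems(4)[rule_format]
  obtain M where M: "strip_matrix (Suc l) n lam mu b M"
    and anti: "antimono (\<lambda>r. lam r - M l r)"
    using exists_strip_matrix_removing_strip[OF Suc.prems(1) lam zero mu] by blast
  define nu where "nu r = lam r - M l r" for r
  have le1: "M j r \<le> 1" for j r using M by (auto simp: strip_matrix_def)
  have row: "mu r + (\<Sum>j<l. M j r) + M l r = lam r" for r
    using M by (auto simp: strip_matrix_def add.assoc)
  have nu_mu: "mu r \<le> nu r" and nu_lam: "lam r = nu r + M l r" for r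
    using row[of r] by (auto simp: nu_def)
  have anti_nu: "antimono nu" using anti unfolding nu_def .
  have zero_nu: "\<forall>r\<ge>n. nu r = 0" using zero by (simp add: nu_def)
  have "strip_matrix l n nu mu b M"
    unfolding strip_matrix_def
  proof (intro conjI allI impI)
    fix r show "mu r + (\<Sum>j<l. M j r) = nu r" using row[of r] by (simp add: nu_def)
  next
    fix j r show "M j r \<le> 1" by (rule le1)
  next
    fix j assume "j < l"
    then show "(\<Sum>r<n. M j r) = b j" using M by (simp add: strip_matrix_def)
  qed
  from Suc.IH[OF this anti_nu mu zero_nu] obtain T where T0: "row_strict_filling l nu mu b T" ..
  have T: "T e < l" if "e \<in> skew_diagram nu mu" for e
    using T0 that by (simp add: row_strict_filling_def)
  have T_row: "T (r, c) < T (r, c')" if "mu r \<le> c" "c < c'" "c' < nu r" for r c c'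
    using T0 that by (simp add: row_strict_filling_def)
  have T_col: "T (r, c) \<le> T (r', c)" if "mu r \<le> c" "r < r'" "c < nu r'" for r r' c
    using T0 that by (simp add: row_strict_filling_def)
  have T_card: "card {e\<in>skew_diagram nu mu. T e = j} = b j" if "j < l" for j
    using T0 that by (simp add: row_strict_filling_def)
  define T' where "T' = (\<lambda>(r, c). if c < nu r then T (r, c) else l)"
  have Tl: "T (r, c) < l" if "mu r \<le> c" "c < nu r" for r c
    using T[of "(r, c)"] that by (simp add: skew_diagram_def)
  have lt: "c < nu r" if "c < c'" "c' < lam r" for r c c'
    using that nu_lam[of r] le1[of l r] by linarith
  have le_nu: "nu r' \<le> nu r" if "r < r'" for r r'
    using antimonoD[OF anti_nu, of r r'] that by simp
  have "\<forall>e\<in>skew_diagram lam mu. T' e < Suc l"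
    using Tl by (force simp: T'_def skew_diagram_def less_Suc_eq)
  moreover have "T' (r, c) < T' (r, c')" if "mu r \<le> c" "c < c'" "c' < lam r" for r c c'
    using that T_row lt[OF that(2,3)] Tl by (auto simp: T'_def)
  moreover have "T' (r, c) \<le> T' (r', c)" if "mu r \<le> c" "r < r'" "c < lam r'" for r r' c
    using that T_col[OF that(1,2)] Tl[of r c] le_nu[OF that(2)] by (auto simp: T'_def)
  moreover have "card {e\<in>skew_diagram lam mu. T' e = j} = b j" if "j < Suc l" for j
  proof (cases "j = l")
    case False
    then have "{e\<in>skew_diagram lam mu. T' e = j} = {e\<in>skew_diagram nu mu. T e = j}"
      using nu_lam by (auto simp: T'_def skew_diagram_def trans_less_add1 split: if_splits)
    then show ?thesis using T_card that False by simp
  next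
    case True
    have "{e\<in>skew_diagram lam mu. T' e = j} = (\<lambda>r. (r, nu r)) ` {r\<in>{..<n}. M l r = 1}"
    proof (intro equalityI subsetI)
      fix e assume "e \<in> {e\<in>skew_diagram lam mu. T' e = j}"
      then obtain r c where e: "e = (r, c)" "mu r \<le> c" "c < lam r" "T' (r, c) = l"
        using True by (auto simp: skew_diagram_def)
      then have c: "\<not> c < nu r" using Tl by (fastforce simp: T'_def)
      then have "c = nu r" "M l r = 1" using e nu_lam[of r] le1[of l r] by linarith+
      moreover have "r < n" using e zero[of r] by (cases "r < n") auto
      ultimately show "e \<in> (\<lambda>r. (r, nu r)) ` {r\<in>{..<n}. M l r = 1}" using e by auto
    next
      fix e assume "e \<in> (\<lambda>r. (r, nu r)) ` {r\<in>{..<n}. M l r = 1}"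
      then show "e \<in> {e\<in>skew_diagram lam mu. T' e = j}"
        using True nu_lam nu_mu by (auto simp: T'_def skew_diagram_def)
    qed
    then have "card {e\<in>skew_diagram lam mu. T' e = j} = card {r\<in>{..<n}. M l r = 1}"
      by (simp add: card_image inj_on_def)
    also have "\<dots> = (\<Sum>r<n. of_bool (M l r = 1))" by (simp add: sum_of_bool_eq Int_def)
    also have "\<dots> = (\<Sum>r<n. M l r)"
      using le1 by (intro sum.cong) (auto simp: le_Suc_eq)
    also have "\<dots> = b l" using M by (simp add: strip_matrix_def)
    finally show ?thesis using True by simp
  qed
  ultimately have "row_strict_filling (Suc l) lam mu b T'"
    unfolding row_strict_filling_def by blast
  then show ?case by (intro exI[of _ T'])
qed

section \<open>The region of the first rows and columns\<close>

definition hook_cells :: "nat \<Rightarrow> nat \<Rightarrow> (nat \<times> nat) set" where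
  "hook_cells i j = {(r, c). r < i \<or> c < j}"

text \<open>This bounds the hook region by the capacity of a cut: the rows in \<open>Y\<close> are counted in full, the
  others with one cell for each of \<open>j\<close> letters.\<close>

lemma card_hook_cells_le:
  assumes "\<And>r. r \<ge> n \<Longrightarrow> lam r = 0" "{..<i} \<subseteq> Y" "Y \<subseteq> {..<n}"
  shows "card (young_diagram lam \<inter> hook_cells i j) \<le> sum lam Y + j * card ({..<n} - Y)"
proof -
  have fin: "finite Y" using assms(3) finite_subset by blast
  have "r < n" if "c < lam r" for r c using assms(1)[of r] that by (cases "r < n") auto
  then have "young_diagram lam \<inter> hook_cells i j
      \<subseteq> (SIGMA r:Y. {..<lam r}) \<union> ({..<n} - Y) \<times> {..<j}"
    using assms(2) by (auto simp: young_diagram_def hook_cells_def)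
  then have "card (young_diagram lam \<inter> hook_cells i j)
      \<le> card ((SIGMA r:Y. {..<lam r}) \<union> ({..<n} - Y) \<times> {..<j})"
    using fin by (intro card_mono) auto
  also have "\<dots> \<le> card (SIGMA r:Y. {..<lam r}) + card (({..<n} - Y) \<times> {..<j})"
    by (rule card_Un_le)
  also have "\<dots> = sum lam Y + j * card ({..<n} - Y)"
    using fin by (simp add: card_cartesian_product mult.commute)
  finally show ?thesis .
qed

section \<open>The shape of the t-letters\<close>

text \<open>The row lengths left to the \<open>t\<close>-letters are \<open>lam r - (\<Sum>j<l. M j r)\<close>. They vanish from row \<open>k\<close> on,
  and the sum of the first \<open>i\<close> of them is at least \<open>A i\<close>; these conditions avoid subtraction on the
  natural numbers.\<close>

definition admissible_matrix where
  "admissible_matrix k l n lam A b M \<longleftrightarrow> (\<forall>j r. M j r \<le> 1) \<and> (\<forall>j<l. (\<Sum>r<n. M j r) = b j)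
    \<and> (\<forall>r. (\<Sum>j<l. M j r) \<le> lam r) \<and> (\<forall>r\<ge>k. (\<Sum>j<l. M j r) = lam r)
    \<and> (\<forall>i\<le>k. A i + (\<Sum>r<i. \<Sum>j<l. M j r) \<le> (\<Sum>r<i. lam r))"
  for lam A b :: "nat \<Rightarrow> nat" and M :: "nat \<Rightarrow> nat \<Rightarrow> nat"

text \<open>The dominance condition becomes part of a transportation problem through auxiliary sources \<open>Inl d\<close>
  with supply \<open>A (Suc d) - A d\<close> that may only serve the rows up to \<open>d\<close>: the first \<open>i\<close> sources together
  put \<open>A i\<close> units into the first \<open>i\<close> rows. The letters \<open>Inr j\<close> supply at most one unit to each row.
  A cut of finite capacity that contains the source \<open>Inl d\<close> contains all rows up to \<open>d\<close>, so the cut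
  condition for it follows from the bound by the hook region with \<open>i = d + 1\<close> for the largest such \<open>d\<close>, or with \<open>i = 0\<close>
  if the cut contains none of the sources.\<close>

lemma exists_admissible_matrix:
  assumes zero: "\<And>r. r \<ge> n \<Longrightarrow> lam r = 0" and kn: "k \<le> n"
    and A0: "A 0 = 0" and Amono: "\<And>i. i < k \<Longrightarrow> A i \<le> A (Suc i)"
    and bound: "\<And>i J. i \<le> k \<Longrightarrow> J \<subseteq> {..<l} \<Longrightarrow>
      A i + sum b J \<le> card (young_diagram lam \<inter> hook_cells i (card J))"
    and total: "A k + sum b {..<l} = sum lam {..<n}"
  shows "\<exists>M. admissible_matrix k l n lam A b M"
proof -
  let ?d = "\<lambda>r. A (Suc r) - A r"
  let ?L = "{..<k} <+> {..<l}"
  define p where "p = case_sum ?d b"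
  \<comment> \<open>The total supply serves as an infinite capacity.\<close>
  define c :: "(nat + nat) \<times> nat \<Rightarrow> nat" where "c = (\<lambda>(x, r). case x of Inl d \<Rightarrow> if r \<le> d then sum p ?L else 0 | Inr _ \<Rightarrow> 1)"
  have telescope: "(\<Sum>r<i. ?d r) = A i" if "i \<le> k" for i
    using that by (induction i) (use A0 Amono in \<open>auto simp: Suc_le_eq\<close>)
  have "sum p ?L = sum lam {..<n}"
    using total telescope[of k] by (simp add: sum.Plus p_def comp_def)
  moreover have "sum p X \<le> sum lam Y + sum c (X \<times> ({..<n} - Y))"
    if X: "X \<subseteq> ?L" and Y: "Y \<subseteq> {..<n}" for X Y
  proof -
    have finX: "finite X" using X by (rule finite_subset) simp
    show ?thesis
    proof (cases "\<exists>d r. Inl d \<in> X \<and> r \<le> d \<and> r \<notin> Y")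
      case True
      then obtain d r where dr: "Inl d \<in> X" "r \<le> d" "r \<notin> Y" by blast
      then have "r < n" using X kn by auto
      then have "sum c {(Inl d, r)} \<le> sum c (X \<times> ({..<n} - Y))"
        using dr finX by (intro sum_mono2) auto
      moreover have "sum p X \<le> sum p ?L" using X by (intro sum_mono2) auto
      ultimately show ?thesis using dr by (simp add: c_def)
    next
      case False
      define D where "D = Inl -` X"
      define J where "J = Inr -` X"
      have XDJ: "X = D <+> J" using X by (auto simp: D_def J_def)
      have D: "D \<subseteq> {..<k}" and J: "J \<subseteq> {..<l}" using X by (auto simp: D_def J_def)
      have finD: "finite D" "finite J" using D J finite_subset by blast+
      obtain i where i: "i \<le> k" "D \<subseteq> {..<i}" "{..<i} \<subseteq> Y"
      proof (cases "D = {}")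
        case True
        with that[of 0] show thesis by simp
      next
        case ne: False
        then have "Max D \<in> D" using finD by simp
        moreover from this have "{..<Suc (Max D)} \<subseteq> Y"
          using False unfolding D_def by auto
        moreover have "Suc (Max D) \<le> k" using \<open>Max D \<in> D\<close> D by (auto simp: Suc_le_eq)
        moreover have "D \<subseteq> {..<Suc (Max D)}" using finD by (auto simp: less_Suc_eq_le)
        ultimately show thesis using that by blast
      qed
      have "sum ?d D \<le> (\<Sum>r<i. ?d r)" using i by (intro sum_mono2) auto
      then have "sum p X \<le> A i + sum b J"
        using telescope[OF i(1)] by (simp add: XDJ sum.Plus finD p_def comp_def)
      also have "\<dots> \<le> card (young_diagram lam \<inter> hook_cells i (card J))"
        using i J by (intro bound)
      also have "\<dots> \<le> sum lam Y + card J * card ({..<n} - Y)"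
        using zero i(3) Y by (rule card_hook_cells_le)
      also have "card J * card ({..<n} - Y) = sum c (Inr ` J \<times> ({..<n} - Y))"
      proof -
        have "sum c (Inr ` J \<times> ({..<n} - Y)) = (\<Sum>e\<in>(Inr ` J :: (nat + nat) set) \<times> ({..<n} - Y). 1)"
          by (intro sum.cong) (auto simp: c_def)
        then show ?thesis by (simp add: card_cartesian_product card_image)
      qed
      also have "sum lam Y + \<dots> \<le> sum lam Y + sum c (X \<times> ({..<n} - Y))"
        using finX by (intro add_left_mono sum_mono2) (auto simp: J_def)
      finally show ?thesis by simp
    qed
  qed
  ultimately obtain N where plan: "transport_plan ?L {..<n} p lam c N"
    using transport_feasible[of ?L "{..<n}" p lam c] by auto
  have N: "N e \<le> c e" "x \<in> ?L \<Longrightarrow> (\<Sum>r<n. N (x, r)) = p x"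
    "r < n \<Longrightarrow> (\<Sum>x\<in>?L. N (x, r)) = lam r" for e x r
    using transport_planD[OF plan] by simp_all
  have col: "(\<Sum>d<k. N (Inl d, r)) + (\<Sum>j<l. N (Inr j, r)) = lam r" if "r < n" for r
    using N(3)[OF that] by (simp add: sum.Plus comp_def)
  have N0: "N (Inl d, r) = 0" if "d < r" for d r using N(1)[of "(Inl d, r)"] that by (simp add: c_def)
  define M where "M j r = (if r < n then N (Inr j, r) else 0)" for j r
  have "M j r \<le> 1" for j r using N(1)[of "(Inr j, r)"] by (simp add: M_def c_def)
  moreover have "(\<Sum>r<n. M j r) = b j" if "j < l" for j
    using N(2)[OF InrI, of j] that by (simp add: M_def p_def)
  moreover have "(\<Sum>j<l. M j r) \<le> lam r" for r
    using col[of r] by (cases "r < n") (auto simp: M_def)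
  moreover have "(\<Sum>j<l. M j r) = lam r" if "r \<ge> k" for r
  proof (cases "r < n")
    case True
    have "(\<Sum>d<k. N (Inl d, r)) = 0" using N0 that by simp
    then show ?thesis using col[OF True] True by (simp add: M_def)
  qed (use zero in \<open>simp add: M_def\<close>)
  moreover have "A i + (\<Sum>r<i. \<Sum>j<l. M j r) \<le> (\<Sum>r<i. lam r)" if "i \<le> k" for i
  proof -
    have "A i = (\<Sum>d<i. \<Sum>r<n. N (Inl d, r))"
      using N(2)[OF InlI] that unfolding telescope[OF that, symmetric]
      by (intro sum.cong) (simp_all add: p_def)
    also have "\<dots> = (\<Sum>d<i. \<Sum>r<i. N (Inl d, r))"
      using that kn by (intro sum.cong sum.mono_neutral_right) (auto intro!: N0)
    also have "\<dots> = (\<Sum>r<i. \<Sum>d<i. N (Inl d, r))" by (rule sum.swap)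
    also have "\<dots> \<le> (\<Sum>r<i. \<Sum>d<k. N (Inl d, r))"
      using that by (intro sum_mono sum_mono2) auto
    finally have "A i + (\<Sum>r<i. \<Sum>j<l. M j r)
        \<le> (\<Sum>r<i. (\<Sum>d<k. N (Inl d, r)) + (\<Sum>j<l. M j r))"
      by (simp add: sum.distrib)
    also have "\<dots> = (\<Sum>r<i. lam r)"
      using that kn by (intro sum.cong) (auto simp: M_def col)
    finally show ?thesis .
  qed
  ultimately show ?thesis unfolding admissible_matrix_def by blast
qed

text \<open>Take an admissible matrix whose ones are as low as possible. If the remaining length of row \<open>r\<close> is
  smaller than that of row \<open>r + 1\<close>, then row \<open>r\<close> of the matrix has more ones than row \<open>r + 1\<close>, so some one
  in row \<open>r\<close> can be moved down by one row. This only increases the partial sums of the remaining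
  lengths, so the matrix stays admissible, against the choice.\<close>

lemma exists_admissible_matrix_partition:
  assumes M: "admissible_matrix k l n lam A b M" and lam: "antimono lam" and kn: "k \<le> n"
  shows "\<exists>M. admissible_matrix k l n lam A b M \<and> antimono (\<lambda>r. lam r - (\<Sum>j<l. M j r))"
proof -
  let ?P = "admissible_matrix k l n lam A b"
    and ?w = "\<lambda>M :: nat \<Rightarrow> nat \<Rightarrow> nat. \<Sum>j<l. \<Sum>r<n. r * M j r"
  have "?w M < Suc (\<Sum>j<l. \<Sum>r<n. r)" if "?P M" for M
    using that by (intro le_imp_less_Suc sum_mono) (auto simp: admissible_matrix_def)
  then have "\<exists>M. ?P M \<and> (\<forall>M'. ?P M' \<longrightarrow> ?w M' \<le> ?w M)"
    using M by (intro ex_has_greatest_nat[of ?P M ?w "Suc (\<Sum>j<l. \<Sum>r<n. r)"]) auto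
  then obtain M where max: "?P M \<and> (\<forall>M'. ?P M' \<longrightarrow> ?w M' \<le> ?w M)"
    by (rule exE)
  have M: "?P M" using max by (rule conjunct1)
  have opt: "?w M' \<le> ?w M" if "?P M'" for M'
    using conjunct2[OF max, rule_format, OF that] .
  have le1: "M j r \<le> 1" and row: "(\<Sum>j<l. M j r) \<le> lam r" for j r
    using M by (auto simp: admissible_matrix_def)
  have "lam (Suc r) - (\<Sum>j<l. M j (Suc r)) \<le> lam r - (\<Sum>j<l. M j r)" for r
  proof (rule ccontr)
    assume "\<not> ?thesis"
    then have *: "(\<Sum>j<l. M j (Suc r)) < (\<Sum>j<l. M j r)" "(\<Sum>j<l. M j (Suc r)) < lam (Suc r)"
      using antimonoD[OF lam, of r "Suc r"] row[of r] by linarith+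
    \<comment> \<open>All of row \<open>r + 1\<close> would belong to the matrix if \<open>k \<le> r + 1\<close>.\<close>
    have rk: "Suc r < k"
    proof (rule ccontr)
      assume "\<not> Suc r < k"
      then have "(\<Sum>j<l. M j (Suc r)) = lam (Suc r)" using M by (simp add: admissible_matrix_def)
      with *(2) show False by simp
    qed
    then have rn: "Suc r < n" using kn by simp
    obtain j where j: "j < l" "M j (Suc r) < M j r"
      using *(1) by (meson lessThan_iff not_le sum_mono)
    then have jv: "M j r = 1" "M j (Suc r) = 0" using le1[of j r] by auto
    let ?M = "M(j := \<lambda>r'. M j (Transposition.transpose r (Suc r) r'))"
    have split: "(\<Sum>j'<l. f j') = f j + (\<Sum>j'\<in>{..<l}-{j}. f j')" for f :: "nat \<Rightarrow> nat"
      using j(1) by (simp add: sum.remove)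
    have rest: "(\<Sum>j'\<in>{..<l}-{j}. ?M j' r') = (\<Sum>j'\<in>{..<l}-{j}. M j' r')" for r'
      by (intro sum.cong) auto
    have "?P ?M"
      unfolding admissible_matrix_def
    proof (intro conjI allI impI)
      fix j' r' show "?M j' r' \<le> 1" using le1 by auto
    next
      fix j' assume "j' < l"
      then show "(\<Sum>r'<n. ?M j' r') = b j'"
        using M rn by (auto simp: admissible_matrix_def sum_transpose_lessThan)
    next
      fix r'
      show "(\<Sum>j'<l. ?M j' r') \<le> lam r'"
      proof (cases "r' = Suc r")
        case True
        then show ?thesis using *(2) jv rest[of r'] by (simp add: split)
      next
        case False
        then have "?M j r' \<le> M j r'" using jv by (auto simp: Transposition.transpose_def)
        then show ?thesis using row[of r'] rest[of r'] by (simp add: split)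
      qed
    next
      fix r' assume "r' \<ge> k"
      then have "?M j r' = M j r'" using rk by (simp add: Transposition.transpose_def)
      then have "(\<Sum>j'<l. ?M j' r') = (\<Sum>j'<l. M j' r')" using rest[of r'] by (simp add: split)
      with \<open>r' \<ge> k\<close> show "(\<Sum>j'<l. ?M j' r') = lam r'" using M by (simp add: admissible_matrix_def)
    next
      fix i assume "i \<le> k"
      have "(\<Sum>r'<i. \<Sum>j'<l. ?M j' r') = (\<Sum>j'<l. \<Sum>r'<i. ?M j' r')" by (rule sum.swap)
      also have "\<dots> \<le> (\<Sum>j'<l. \<Sum>r'<i. M j' r')"
      proof (rule sum_mono)
        fix j'
        show "(\<Sum>r'<i. ?M j' r') \<le> (\<Sum>r'<i. M j' r')"
          using prefix_sum_transpose[of "M j" r i] jv by (cases "j' = j") simp_all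
      qed
      also have "\<dots> = (\<Sum>r'<i. \<Sum>j'<l. M j' r')" by (rule sum.swap)
      finally show "A i + (\<Sum>r'<i. \<Sum>j'<l. ?M j' r') \<le> (\<Sum>r'<i. lam r')"
        using M \<open>i \<le> k\<close> unfolding admissible_matrix_def by (meson add_left_mono le_trans)
    qed
    then have "?w ?M \<le> ?w M" by (rule opt)
    moreover have "(\<Sum>j'\<in>{..<l}-{j}. \<Sum>r'<n. r' * ?M j' r') = (\<Sum>j'\<in>{..<l}-{j}. \<Sum>r'<n. r' * M j' r')"
      by (intro sum.cong) auto
    ultimately show False using weighted_sum_transpose[of r n "M j"] rn jv by (simp add: split)
  qed
  then have "antimono (\<lambda>r. lam r - (\<Sum>j<l. M j r))" by (rule antimono_iff_le_Suc[THEN iffD2, OF allI])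
  with M show ?thesis by blast
qed

section \<open>Tableaux with prescribed content\<close>

lemma card_young_diagram:
  assumes "\<And>r. r \<ge> n \<Longrightarrow> lam r = 0"
  shows "card (young_diagram lam) = sum lam {..<n}"
proof -
  have "r < n" if "c < lam r" for r c using assms(1)[of r] that by (cases "r < n") auto
  then have "young_diagram lam = (SIGMA r:{..<n}. {..<lam r})" by (auto simp: young_diagram_def)
  then show ?thesis by simp
qed

definition conjugate :: "(nat \<Rightarrow> nat) \<Rightarrow> nat \<Rightarrow> nat" where
  "conjugate mu c = (LEAST r. mu r \<le> c)"

lemma less_conjugate_iff:
  assumes "antimono mu" "mu k = 0"
  shows "r < conjugate mu c \<longleftrightarrow> c < mu r"
proof
  assume "r < conjugate mu c"
  then show "c < mu r" unfolding conjugate_def by (meson not_le not_less_Least)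
next
  assume "c < mu r"
  moreover have "mu (conjugate mu c) \<le> c"
    unfolding conjugate_def by (rule LeastI[of _ k]) (simp add: assms(2))
  ultimately show "r < conjugate mu c"
    using antimonoD[OF assms(1), of "conjugate mu c" r] by (meson le_trans not_le)
qed

lemma antimono_conjugate:
  assumes "antimono mu" "mu k = 0"
  shows "antimono (conjugate mu)"
proof (rule antimonoI)
  fix c c' :: nat assume "c \<le> c'"
  then have "r < conjugate mu c" if "r < conjugate mu c'" for r
    using that by (simp add: less_conjugate_iff[OF assms])
  then show "conjugate mu c' \<le> conjugate mu c" by (meson not_le less_irrefl)
qed

text \<open>The \<open>t\<close>-letters strictly increase down columns, so a filling of \<open>mu\<close> with them is a row-strict filling
  of the conjugate shape. Its matrix assigns letters to columns of \<open>mu\<close>, at most once each; the cut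
  conditions hold since \<open>|I|\<close> letters fit into the first \<open>|I|\<close> rows of \<open>mu\<close>, whose columns have length at
  most \<open>|I|\<close>.\<close>

lemma exists_tableau_of_dominated_content:
  assumes mu: "antimono mu" and zero: "\<And>r. r \<ge> k \<Longrightarrow> mu r = 0"
    and dom: "\<And>I. I \<subseteq> {..<k} \<Longrightarrow> sum a I \<le> sum mu {..<card I}"
    and total: "sum a {..<k} = sum mu {..<k}"
  shows "\<exists>T. row_strict_filling k (conjugate mu) (\<lambda>_. 0) a T"
proof -
  define n where "n = mu 0"
  have mk: "mu k = 0" using zero by simp
  note conj_iff = less_conjugate_iff[OF mu mk]
  have anti: "antimono (conjugate mu)" using mu mk by (rule antimono_conjugate)
  have zero': "conjugate mu c = 0" if "c \<ge> n" for c
  proof (rule ccontr)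
    assume "conjugate mu c \<noteq> 0"
    then have "0 < conjugate mu c" by simp
    with that show False by (simp add: conj_iff n_def)
  qed
  have yd: "young_diagram (conjugate mu) = prod.swap ` young_diagram mu"
    by (force simp: young_diagram_def conj_iff image_iff)
  have "card (young_diagram (conjugate mu)) = card (young_diagram mu)"
    unfolding yd by (rule card_image) simp
  then have "sum a {..<k} = sum (conjugate mu) {..<n}"
    using total card_young_diagram[of k mu] card_young_diagram[of n "conjugate mu"] zero zero' by simp
  moreover have "sum a I \<le> sum (conjugate mu) Y + (\<Sum>e\<in>I \<times> ({..<n} - Y). 1)"
    if I: "I \<subseteq> {..<k}" and Y: "Y \<subseteq> {..<n}" for I Y
  proof -
    have "young_diagram mu \<inter> hook_cells (card I) 0 = (SIGMA r:{..<card I}. {..<mu r})"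
      by (auto simp: young_diagram_def hook_cells_def)
    then have "sum mu {..<card I} = card (young_diagram mu \<inter> hook_cells (card I) 0)" by simp
    also have "\<dots> = card (prod.swap ` (young_diagram mu \<inter> hook_cells (card I) 0))"
      by (rule card_image[symmetric]) simp
    also have "prod.swap ` (young_diagram mu \<inter> hook_cells (card I) 0)
        = young_diagram (conjugate mu) \<inter> hook_cells 0 (card I)"
      by (force simp: young_diagram_def conj_iff hook_cells_def image_iff)
    also have "card \<dots> \<le> sum (conjugate mu) Y + card I * card ({..<n} - Y)"
      by (rule card_hook_cells_le) (use zero' Y in auto)
    finally show ?thesis
      using dom[OF I] by (simp add: card_cartesian_product)
  qed
  ultimately obtain N where plan: "transport_plan {..<k} {..<n} a (conjugate mu) (\<lambda>_. 1) N"
    using transport_feasible[of "{..<k}" "{..<n}" a "conjugate mu" "\<lambda>_. 1"] by auto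
  have N: "N e \<le> 1" "j < k \<Longrightarrow> (\<Sum>c<n. N (j, c)) = a j"
    "c < n \<Longrightarrow> (\<Sum>j<k. N (j, c)) = conjugate mu c" for e j c
    using transport_planD[OF plan] by simp_all
  define M where "M j c = (if c < n then N (j, c) else 0)" for j c
  have "strip_matrix k n (conjugate mu) (\<lambda>_. 0) a M"
    unfolding strip_matrix_def
  proof (intro conjI allI impI)
    show "M j c \<le> 1" for j c using N(1) by (simp add: M_def)
    show "0 + (\<Sum>j<k. M j c) = conjugate mu c" for c
      using N(3) zero' by (cases "c < n") (simp_all add: M_def)
    show "(\<Sum>c<n. M j c) = a j" if "j < k" for j using N(2)[OF that] by (simp add: M_def)
  qed
  from exists_row_strict_filling[OF this anti _ ] zero' show ?thesis
    by (simp add: antimonoI)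
qed

lemma exists_inner_shape:
  assumes lam: "antimono lam" and zero: "\<And>r. r \<ge> n \<Longrightarrow> lam r = 0" and kn: "k \<le> n"
    and A0: "A 0 = 0" and Amono: "\<And>i. i < k \<Longrightarrow> A i \<le> A (Suc i)"
    and bound: "\<And>i J. i \<le> k \<Longrightarrow> J \<subseteq> {..<l} \<Longrightarrow>
      A i + sum b J \<le> card (young_diagram lam \<inter> hook_cells i (card J))"
    and total: "A k + sum b {..<l} = sum lam {..<n}"
  shows "\<exists>mu M. antimono mu \<and> strip_matrix l n lam mu b M \<and> (\<forall>r\<ge>k. mu r = 0)
    \<and> (\<forall>i\<le>k. A i \<le> sum mu {..<i})"
proof -
  obtain M0 where "admissible_matrix k l n lam A b M0"
    using exists_admissible_matrix[OF zero kn A0 Amono bound total] by blast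
  from exists_admissible_matrix_partition[OF this lam kn]
  obtain M where M: "admissible_matrix k l n lam A b M"
    and anti: "antimono (\<lambda>r. lam r - (\<Sum>j<l. M j r))" by blast
  define mu where "mu = (\<lambda>r. lam r - (\<Sum>j<l. M j r))"
  have row: "mu r + (\<Sum>j<l. M j r) = lam r" for r
    using M by (simp add: mu_def admissible_matrix_def)
  show ?thesis
  proof (intro exI[of _ mu] exI[of _ M] conjI allI impI)
    show "antimono mu" using anti by (simp add: mu_def)
    show "strip_matrix l n lam mu b M"
      using M row by (simp add: strip_matrix_def admissible_matrix_def)
    show "mu r = 0" if "r \<ge> k" for r using M that by (simp add: mu_def admissible_matrix_def)
    show "A i \<le> sum mu {..<i}" if "i \<le> k" for i
    proof -
      have "(\<Sum>r<i. lam r) = sum mu {..<i} + (\<Sum>r<i. \<Sum>j<l. M j r)"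
        by (simp add: row[symmetric] sum.distrib del: row)
      then show ?thesis using M that unfolding admissible_matrix_def
        by (metis add_le_cancel_right)
    qed
  qed
qed

lemma exists_SSYT_of_fillings:
  assumes mu: "antimono mu" "mu k = 0" and le: "\<And>r. mu r \<le> lam r"
    and T1: "row_strict_filling k (conjugate mu) (\<lambda>_. 0) a T1"
    and T2: "row_strict_filling l lam mu b T2"
  shows "\<exists>T\<in>SSYT k l lam. (\<forall>i<k. multiplicity_in lam T i = a i)
    \<and> (\<forall>j<l. multiplicity_in lam T (k + j) = b j)"
proof -
  note conj_iff = less_conjugate_iff[OF mu]
  define T where "T = (\<lambda>(r, c). if c < lam r then
    (if c < mu r then T1 (c, r) else k + T2 (r, c)) else undefined)"
  have t: "T1 (c, r) < k" if "c < mu r" for r c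
    using T1 that by (simp add: row_strict_filling_def skew_diagram_def conj_iff)
  have t_row: "T1 (c, r) \<le> T1 (c', r)" if "c < c'" "c' < mu r" for r c c'
    using T1 that by (simp add: row_strict_filling_def conj_iff)
  have t_col: "T1 (c, r) < T1 (c, r')" if "r < r'" "c < mu r'" for r r' c
    using T1 that by (simp add: row_strict_filling_def conj_iff)
  have u: "T2 (r, c) < l" if "mu r \<le> c" "c < lam r" for r c
    using T2 that by (simp add: row_strict_filling_def skew_diagram_def)
  have u_row: "T2 (r, c) < T2 (r, c')" if "mu r \<le> c" "c < c'" "c' < lam r" for r c c'
    using T2 that by (simp add: row_strict_filling_def)
  have u_col: "T2 (r, c) \<le> T2 (r', c)" if "mu r \<le> c" "r < r'" "c < lam r'" for r r' c
    using T2 that by (simp add: row_strict_filling_def)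
  have mu_le: "mu r' \<le> mu r" if "r < r'" for r r' using antimonoD[OF mu(1), of r r'] that by simp
  have "T \<in> SSYT k l lam"
    unfolding SSYT_def
  proof (intro CollectI conjI allI impI)
    show "T \<in> young_diagram lam \<rightarrow>\<^sub>E {..<k + l}"
    proof (rule PiE_I)
      fix e assume "e \<in> young_diagram lam"
      then obtain r c where "e = (r, c)" "c < lam r" by (auto simp: young_diagram_def)
      then show "T e \<in> {..<k + l}"
        using t[of c r] u[of r c] by (cases "c < mu r") (simp_all add: T_def)
    next
      fix e assume "e \<notin> young_diagram lam"
      then show "T e = undefined" by (cases e) (simp add: T_def young_diagram_def)
    qed
  next
    fix i j j' assume "(i, j) \<in> young_diagram lam \<and> (i, j') \<in> young_diagram lam \<and> j < j'"
    then have A: "j < lam i" "j' < lam i" "j < j'" by (simp_all add: young_diagram_def)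
    consider "j' < mu i" | "j < mu i" "mu i \<le> j'" | "mu i \<le> j" by linarith
    then have "T (i, j) \<le> T (i, j') \<and> (k \<le> T (i, j) \<longrightarrow> T (i, j) < T (i, j'))"
    proof cases
      case 1
      then show ?thesis using A t[of j i] t_row[of j j' i] by (simp add: T_def)
    next
      case 2
      then show ?thesis using A t[of j i] by (simp add: T_def)
    next
      case 3
      then show ?thesis using A u_row[of i j j'] by (simp add: T_def)
    qed
    then show "T (i, j) \<le> T (i, j')"
      and "k \<le> T (i, j) \<and> k \<le> T (i, j') \<Longrightarrow> T (i, j) < T (i, j')" by blast+
  next
    fix i i' j assume "(i, j) \<in> young_diagram lam \<and> (i', j) \<in> young_diagram lam \<and> i < i'"
    then have A: "j < lam i" "j < lam i'" "i < i'" by (simp_all add: young_diagram_def)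
    consider "j < mu i'" | "j < mu i" "mu i' \<le> j" | "mu i \<le> j" by linarith
    then have "T (i, j) \<le> T (i', j) \<and> (T (i', j) < k \<longrightarrow> T (i, j) < T (i', j))"
    proof cases
      case 1
      then show ?thesis using A t_col[of i i' j] mu_le[OF A(3)] by (simp add: T_def)
    next
      case 2
      then show ?thesis using A t[of j i] by (simp add: T_def)
    next
      case 3
      then show ?thesis using A u_col[of i j i'] mu_le[OF A(3)] by (simp add: T_def)
    qed
    then show "T (i, j) \<le> T (i', j)"
      and "T (i, j) < k \<and> T (i', j) < k \<Longrightarrow> T (i, j) < T (i', j)" by blast+
  qed
  moreover have "multiplicity_in lam T i = a i" if "i < k" for i
  proof -
    have "(r, c) \<in> young_diagram lam \<and> T (r, c) = i \<longleftrightarrow> c < mu r \<and> T1 (c, r) = i" for r c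
      using that le[of r] by (simp add: T_def young_diagram_def)
    then have "{e \<in> young_diagram lam. T e = i} = {(r, c). c < mu r \<and> T1 (c, r) = i}"
      by (simp only: set_eq_iff split_paired_all mem_Collect_eq split) blast
    moreover have "{e \<in> skew_diagram (conjugate mu) (\<lambda>_. 0). T1 e = i}
        = prod.swap ` {(r, c). c < mu r \<and> T1 (c, r) = i}"
      by (auto simp: skew_diagram_def conj_iff image_iff)
    ultimately have "multiplicity_in lam T i = card {e \<in> skew_diagram (conjugate mu) (\<lambda>_. 0). T1 e = i}"
      by (simp add: multiplicity_in_def card_image)
    then show ?thesis using T1 that by (simp add: row_strict_filling_def)
  qed
  moreover have "multiplicity_in lam T (k + j) = b j" if "j < l" for j
  proof -
    have "T1 (c, r) \<noteq> k + j" if "c < mu r" for r c using t[OF that] by simp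
    then have "{e \<in> young_diagram lam. T e = k + j} = {e \<in> skew_diagram lam mu. T2 e = j}"
      by (auto simp: T_def young_diagram_def skew_diagram_def split: if_splits)
    then show ?thesis using T2 that by (simp add: multiplicity_in_def row_strict_filling_def)
  qed
  ultimately show ?thesis by blast
qed

lemma sum_lessThan_add:
  fixes f :: "nat \<Rightarrow> nat"
  shows "sum f {..<k + l} = sum f {..<k} + (\<Sum>j<l. f (k + j))"
  by (induction l) auto

text \<open>The converse of the inequalities for contents. The \<open>t\<close>-multiplicities need not be sorted, so the
  dominance condition is expressed by the largest sums \<open>A i\<close> over \<open>i\<close> of them.\<close>

lemma exists_SSYT_with_content:
  assumes lam: "antimono lam" and zero: "\<And>r. r \<ge> n \<Longrightarrow> lam r = 0" and kn: "k \<le> n"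
    and bound: "\<And>S. S \<subseteq> {..<k + l} \<Longrightarrow> sum f S
      \<le> card (young_diagram lam \<inter> hook_cells (card (S \<inter> {..<k})) (card (S - {..<k})))"
    and total: "sum f {..<k + l} = card (young_diagram lam)"
  shows "\<exists>T\<in>SSYT k l lam. \<forall>v<k + l. multiplicity_in lam T v = f v"
proof -
  let ?F = "\<lambda>i. {I. I \<subseteq> {..<k} \<and> card I = i}"
  define A where "A i = Max (sum f ` ?F i)" for i
  define b where "b j = f (k + j)" for j
  have fin: "finite (?F i)" for i by (rule finite_subset[of _ "Pow {..<k}"]) auto
  have upper: "sum f I \<le> A (card I)" if "I \<subseteq> {..<k}" for I
    unfolding A_def using fin that by (intro Max_ge) auto
  have attained: "\<exists>I. I \<subseteq> {..<k} \<and> card I = i \<and> A i = sum f I" if "i \<le> k" for i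
  proof -
    have "{..<i} \<in> ?F i" using that by auto
    then have "A i \<in> sum f ` ?F i" unfolding A_def using fin by (intro Max_in finite_imageI) blast+
    then obtain I where "I \<in> ?F i" "A i = sum f I" by (rule imageE) simp
    then show ?thesis by blast
  qed
  have A0: "A 0 = 0"
  proof -
    obtain I where I: "I \<subseteq> {..<k}" "card I = 0" "A 0 = sum f I" using attained[OF le0] by blast
    then have "finite I" using finite_subset by blast
    then show ?thesis using I by simp
  qed
  have Ak: "A k = sum f {..<k}"
  proof -
    obtain I where I: "I \<subseteq> {..<k}" "card I = k" "A k = sum f I" using attained[OF order_refl] by blast
    then have "I = {..<k}" by (intro card_subset_eq) simp_all
    with I(3) show ?thesis by simp
  qed
  have split: "sum f {..<k + l} = sum f {..<k} + sum b {..<l}"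
    unfolding b_def by (rule sum_lessThan_add)
  have total': "A k + sum b {..<l} = sum lam {..<n}"
    using total split Ak card_young_diagram[of n lam] zero by simp
  have Amono: "A i \<le> A (Suc i)" if "i < k" for i
  proof -
    have "i \<le> k" using that by simp
    from attained[OF this] obtain I
      where I: "I \<subseteq> {..<k}" "card I = i" "A i = sum f I" by blast
    have finI: "finite I" using I(1) finite_subset by blast
    have "I \<noteq> {..<k}" using I(2) that by auto
    then obtain x where x: "x < k" "x \<notin> I" using I(1) by blast
    have "sum f I \<le> sum f (insert x I)" using finI by (intro sum_mono2) auto
    also have "\<dots> \<le> A (card (insert x I))" using I(1) x by (intro upper) auto
    finally show ?thesis using I x finI by simp
  qed
  have bound': "A i + sum b J \<le> card (young_diagram lam \<inter> hook_cells i (card J))"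
    if "i \<le> k" "J \<subseteq> {..<l}" for i J
  proof -
    obtain I where I: "I \<subseteq> {..<k}" "card I = i" "A i = sum f I"
      using attained[OF \<open>i \<le> k\<close>] by blast
    \<comment> \<open>The hypothesis is used for a set of \<open>t\<close>-letters that attains \<open>A i\<close> and the \<open>u\<close>-letters of \<open>J\<close>.\<close>
    let ?S = "I \<union> (+) k ` J"
    have fin': "finite I" "finite J" using I(1) that(2) finite_subset by blast+
    have "sum f ?S = sum f I + sum f ((+) k ` J)"
      using fin' I(1) by (intro sum.union_disjoint) auto
    also have "sum f ((+) k ` J) = sum b J"
      by (subst sum.reindex) (simp_all add: b_def comp_def)
    finally have "sum f ?S = A i + sum b J" using I(3) by simp
    moreover have "?S \<inter> {..<k} = I" "?S - {..<k} = (+) k ` J" using I(1) by auto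
    moreover have "card ((+) k ` J) = card J" by (simp add: card_image)
    moreover have "?S \<subseteq> {..<k + l}" using I(1) that(2) by auto
    ultimately show ?thesis using bound[of ?S] I(2) by simp
  qed
  have "\<exists>mu M. antimono mu \<and> strip_matrix l n lam mu b M \<and> (\<forall>r\<ge>k. mu r = 0)
      \<and> (\<forall>i\<le>k. A i \<le> sum mu {..<i})"
    by (rule exists_inner_shape) (fact lam zero kn A0 Amono bound' total')+
  then obtain mu M where mu: "antimono mu" and M: "strip_matrix l n lam mu b M"
    and mu_zero: "\<forall>r\<ge>k. mu r = 0" and mu_dom: "\<forall>i\<le>k. A i \<le> sum mu {..<i}" by blast
  have muk: "mu r = 0" if "r \<ge> k" for r using mu_zero that by blast
  have dom: "A i \<le> sum mu {..<i}" if "i \<le> k" for i using mu_dom that by blast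
  have zero': "\<forall>r\<ge>n. lam r = 0" using zero by simp
  obtain T2 where T2: "row_strict_filling l lam mu b T2"
    using exists_row_strict_filling[OF M lam mu zero'] by blast
  have mu_lam: "mu r \<le> lam r" for r using M unfolding strip_matrix_def by (metis le_add1)
  have sum_mu: "sum mu {..<k} = A k"
  proof -
    have "sum mu {..<k} = sum mu {..<n}"
      using kn muk by (intro sum.mono_neutral_left) auto
    moreover have "sum mu {..<n} + (\<Sum>r<n. \<Sum>j<l. M j r) = sum lam {..<n}"
      using M by (simp add: strip_matrix_def sum.distrib[symmetric])
    moreover have "(\<Sum>r<n. \<Sum>j<l. M j r) = sum b {..<l}"
      using M by (subst sum.swap) (simp add: strip_matrix_def)
    ultimately show ?thesis using total' by simp
  qed
  then have total_mu: "sum f {..<k} = sum mu {..<k}" using Ak by simp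
  have dom_mu: "sum f I \<le> sum mu {..<card I}" if "I \<subseteq> {..<k}" for I
  proof -
    have "card I \<le> k" using card_mono[OF _ that] by simp
    then show ?thesis using upper[OF that] dom[of "card I"] by linarith
  qed
  have "\<exists>T1. row_strict_filling k (conjugate mu) (\<lambda>_. 0) f T1"
    by (rule exists_tableau_of_dominated_content) (fact mu muk dom_mu total_mu)+
  then obtain T1 where T1: "row_strict_filling k (conjugate mu) (\<lambda>_. 0) f T1" by (rule exE)
  have "\<exists>T\<in>SSYT k l lam. (\<forall>i<k. multiplicity_in lam T i = f i)
      \<and> (\<forall>j<l. multiplicity_in lam T (k + j) = b j)"
    by (rule exists_SSYT_of_fillings[OF mu muk[OF order_refl] mu_lam T1 T2])
  then obtain T where T: "T \<in> SSYT k l lam" "\<forall>i<k. multiplicity_in lam T i = f i"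
    "\<forall>j<l. multiplicity_in lam T (k + j) = b j" by blast
  have "multiplicity_in lam T v = f v" if "v < k + l" for v
  proof (cases "v < k")
    case False
    then show ?thesis using T(3)[rule_format, of "v - k"] that by (simp add: b_def)
  qed (use T(2) in simp)
  with T(1) show ?thesis by blast
qed

section \<open>Inequalities for contents of tableaux\<close>

lemma SSYT_north_west:
  assumes "T \<in> SSYT k l lam" "(r, c) \<in> young_diagram lam" "r' \<le> r" "c' \<le> c" "antimono lam"
  shows "(r', c') \<in> young_diagram lam" "T (r', c') \<le> T (r, c)"
proof -
  have "lam r \<le> lam r'" using assms(3,5) by (simp add: antimonoD)
  then show in1: "(r', c') \<in> young_diagram lam" using assms(2,4) by (auto simp: young_diagram_def)
  have in2: "(r, c') \<in> young_diagram lam" using assms(2,4) by (auto simp: young_diagram_def)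
  have "T (r', c') \<le> T (r, c')"
    using assms(1,3) in1 in2 by (cases "r' = r") (auto simp: SSYT_def)
  also have "T (r, c') \<le> T (r, c)"
    using assms(1,2,4) in2 by (cases "c' = c") (auto simp: SSYT_def)
  finally show "T (r', c') \<le> T (r, c)" .
qed

text \<open>The cells with letters below \<open>v\<close> form the shape at stage \<open>v\<close>, and the hook region has one row for
  each selected \<open>t\<close>-letter and one column for each selected \<open>u\<close>-letter below \<open>v\<close>. If the letter \<open>v\<close> is a
  selected \<open>u\<close>-letter, the region gains column \<open>j\<close>, and each cell of letter \<open>v\<close> outside the old
  region is pushed left to that column. No two cells of
  letter \<open>v\<close> share a row, so the images are distinct, and they are new cells of the region. The case
  of a \<open>t\<close>-letter is the transposed one.\<close>

lemma card_letters_le_hook_cells: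
  assumes T: "T \<in> SSYT k l lam" and lam: "is_partition lam"
  shows "card {e \<in> young_diagram lam. T e < v \<and> T e \<in> S}
    \<le> card ({e \<in> young_diagram lam. T e < v}
        \<inter> hook_cells (card (S \<inter> {..<k} \<inter> {..<v})) (card ((S - {..<k}) \<inter> {..<v})))"
proof (induction v)
  case 0
  then show ?case by simp
next
  case (Suc v)
  have anti: "antimono lam" using lam by (simp add: is_partition_def)
  have fin: "finite (young_diagram lam)" using lam by (rule finite_young_diagram)
  let ?D = "\<lambda>v. {e \<in> young_diagram lam. T e < v}"
  let ?i = "card (S \<inter> {..<k} \<inter> {..<v})" and ?j = "card ((S - {..<k}) \<inter> {..<v})"
  let ?H = "hook_cells ?i ?j"
  let ?H' = "hook_cells (card (S \<inter> {..<k} \<inter> {..<Suc v})) (card ((S - {..<k}) \<inter> {..<Suc v}))"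
  note down = SSYT_north_west[OF T _ _ _ anti]
  show ?case
  proof (cases "v \<in> S")
    case False
    then have "{e \<in> young_diagram lam. T e < Suc v \<and> T e \<in> S} = {e \<in> young_diagram lam. T e < v \<and> T e \<in> S}"
      by (auto simp: less_Suc_eq)
    moreover have "?H' = ?H" using False by (simp add: lessThan_Suc)
    moreover have "card (?D v \<inter> ?H) \<le> card (?D (Suc v) \<inter> ?H)"
      using fin by (intro card_mono) auto
    ultimately show ?thesis using Suc.IH by simp
  next
    case True
    let ?V = "{e \<in> young_diagram lam. T e = v}"
    have split: "{e \<in> young_diagram lam. T e < Suc v \<and> T e \<in> S}
        = {e \<in> young_diagram lam. T e < v \<and> T e \<in> S} \<union> ?V"
      using True by (auto simp: less_Suc_eq)
    have disj: "{e \<in> young_diagram lam. T e < v \<and> T e \<in> S} \<inter> ?V = {}" by auto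
    define g where "g = (\<lambda>(r, c). if v < k then (if c < ?j then (r, c) else (min r ?i, c))
      else (if r < ?i then (r, c) else (r, min c ?j)))"
    have H': "?H' = (if v < k then hook_cells (Suc ?i) ?j else hook_cells ?i (Suc ?j))"
      using True by (auto simp: lessThan_Suc Int_insert_right)
    have inj: "inj_on g ?V"
    proof (rule inj_onI)
      fix e e' assume e: "e \<in> ?V" "e' \<in> ?V" and eq: "g e = g e'"
      obtain r c r' c' where rc: "e = (r, c)" "e' = (r', c')" by (metis surj_pair)
      show "e = e'"
      proof (cases "v < k")
        case vk: True
        then have "c = c'" using eq by (auto simp: rc g_def split: if_splits)
        moreover have "r = r'"
          using T e vk unfolding rc \<open>c = c'\<close> SSYT_def
          by (metis (mono_tags, lifting) less_irrefl linorder_neqE_nat mem_Collect_eq)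
        ultimately show ?thesis by (simp add: rc)
      next
        case vk: False
        then have "r = r'" using eq by (auto simp: rc g_def split: if_splits)
        moreover have "c = c'"
          using T e vk unfolding rc \<open>r = r'\<close> SSYT_def
          by (metis (mono_tags, lifting) less_irrefl linorder_neqE_nat mem_Collect_eq not_less)
        ultimately show ?thesis by (simp add: rc)
      qed
    qed
    have sub: "g ` ?V \<subseteq> ?D (Suc v) \<inter> ?H'"
    proof
      fix x assume "x \<in> g ` ?V"
      then obtain r c where rc: "(r, c) \<in> young_diagram lam" "T (r, c) = v" "x = g (r, c)" by auto
      then have "g (r, c) \<in> young_diagram lam \<and> T (g (r, c)) \<le> v"
        using down[OF rc(1), of "min r ?i" c] down[OF rc(1), of r "min c ?j"]
        by (auto simp: g_def)
      moreover have "g (r, c) \<in> ?H'" unfolding H' by (auto simp: g_def hook_cells_def)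
      ultimately show "x \<in> ?D (Suc v) \<inter> ?H'" by (simp add: rc(3) less_Suc_eq_le)
    qed
    \<comment> \<open>A cell that is moved lands outside the old region, and a cell that is not moved has letter \<open>v\<close>.\<close>
    have new: "g ` ?V \<inter> (?D v \<inter> ?H) = {}"
      by (auto simp: g_def hook_cells_def min_def split: if_splits)
    have "card (?D v \<inter> ?H) + card ?V = card (?D v \<inter> ?H) + card (g ` ?V)"
      using inj by (simp add: card_image)
    also have "\<dots> = card ((?D v \<inter> ?H) \<union> g ` ?V)"
      using fin new by (intro card_Un_disjoint[symmetric]) auto
    also have "\<dots> \<le> card (?D (Suc v) \<inter> ?H')"
    proof (rule card_mono)
      have "?H \<subseteq> ?H'" unfolding H' by (auto simp: hook_cells_def)
      then show "(?D v \<inter> ?H) \<union> g ` ?V \<subseteq> ?D (Suc v) \<inter> ?H'" using sub by auto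
    qed (use fin in simp)
    finally show ?thesis
      unfolding split using Suc.IH fin disj by (simp add: card_Un_disjoint)
  qed
qed

lemma sum_multiplicity_in:
  assumes "is_partition lam" "finite S"
  shows "(\<Sum>v\<in>S. multiplicity_in lam T v) = card {e \<in> young_diagram lam. T e \<in> S}"
proof -
  have "{e \<in> young_diagram lam. T e \<in> S} = (\<Union>v\<in>S. {e \<in> young_diagram lam. T e = v})" by auto
  moreover have "card (\<Union>v\<in>S. {e \<in> young_diagram lam. T e = v})
      = (\<Sum>v\<in>S. card {e \<in> young_diagram lam. T e = v})"
    using assms finite_young_diagram[OF assms(1)] by (intro card_UN_disjoint) auto
  ultimately show ?thesis by (simp add: multiplicity_in_def)
qed

lemma sum_multiplicity_in_le_hook_cells:
  assumes T: "T \<in> SSYT k l lam" and lam: "is_partition lam" and S: "S \<subseteq> {..<k + l}"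
  shows "(\<Sum>v\<in>S. multiplicity_in lam T v)
    \<le> card (young_diagram lam \<inter> hook_cells (card (S \<inter> {..<k})) (card (S - {..<k})))"
proof -
  have lt: "T e < k + l" if "e \<in> young_diagram lam" for e
    using T that unfolding SSYT_def by (blast dest: PiE_mem)
  have "finite S" using S finite_subset by blast
  then have "(\<Sum>v\<in>S. multiplicity_in lam T v) = card {e \<in> young_diagram lam. T e \<in> S}"
    using lam by (intro sum_multiplicity_in)
  also have "{e \<in> young_diagram lam. T e \<in> S} = {e \<in> young_diagram lam. T e < k + l \<and> T e \<in> S}"
    using lt by auto
  also note card_letters_le_hook_cells[OF T lam, of "k + l" S]
  also have "{e \<in> young_diagram lam. T e < k + l} = young_diagram lam" using lt by auto
  also have "S \<inter> {..<k} \<inter> {..<k + l} = S \<inter> {..<k}" using S by auto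
  also have "(S - {..<k}) \<inter> {..<k + l} = S - {..<k}" using S by auto
  finally show ?thesis .
qed

lemma sum_multiplicity_in_all:
  assumes T: "T \<in> SSYT k l lam" and lam: "is_partition lam"
  shows "(\<Sum>v<k + l. multiplicity_in lam T v) = card (young_diagram lam)"
proof -
  have "{e \<in> young_diagram lam. T e \<in> {..<k + l}} = young_diagram lam"
    using T by (auto simp: SSYT_def PiE_def Pi_def)
  then show ?thesis using sum_multiplicity_in[OF lam, of "{..<k + l}" T] by simp
qed

section \<open>The Newton polytope\<close>

definition content :: "nat \<Rightarrow> (nat \<Rightarrow> nat) \<Rightarrow> (nat \<times> nat \<Rightarrow> nat) \<Rightarrow> nat \<Rightarrow>\<^sub>0 nat" where
  "content d lam T = (\<Sum>v<d. Poly_Mapping.single v (multiplicity_in lam T v))"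

lemma lookup_content:
  "Poly_Mapping.lookup (content d lam T) v = (if v < d then multiplicity_in lam T v else 0)"
  by (simp add: content_def lookup_sum lookup_single when_def)

lemma Var_power: "Var i ^ m = Poly_Mapping.single (Poly_Mapping.single i m) (1 :: 'a :: comm_semiring_1)"
  by (induction m) (simp_all add: Var_def mult_single single_add[symmetric])

lemma prod_single_one:
  "(\<Prod>i\<in>A. Poly_Mapping.single (e i) (1 :: 'a :: comm_semiring_1)) = Poly_Mapping.single (\<Sum>i\<in>A. e i) 1"
  by (induction A rule: infinite_finite_induct) (simp_all add: mult_single)

lemma super_schur_eq:
  "super_schur k l lam = (\<Sum>T\<in>SSYT k l lam. Poly_Mapping.single (content (k + l) lam T) 1)"
proof -
  have "(\<Sum>v<k + l. e v) = (\<Sum>i<k. e i) + (\<Sum>j<l. e (k + j))" for e :: "nat \<Rightarrow> nat \<Rightarrow>\<^sub>0 nat"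
    by (induction l) (simp_all add: add.assoc)
  then show ?thesis
    by (simp add: super_schur_def Var_power prod_single_one mult_single content_def)
qed

text \<open>All coefficients are \<open>1\<close>, so nothing cancels.\<close>

lemma keys_sum_single_one:
  assumes "finite X"
  shows "Poly_Mapping.keys (\<Sum>x\<in>X. Poly_Mapping.single (e x) (1 :: int)) = e ` X"
proof -
  have "Poly_Mapping.lookup (\<Sum>x\<in>X. Poly_Mapping.single (e x) (1 :: int)) a
      = int (card {x \<in> X. a = e x})" for a
    using assms by (simp add: lookup_sum lookup_single when_def sum.inter_filter[symmetric] eq_commute)
  then show ?thesis using assms by (auto simp: in_keys_iff card_eq_0_iff)
qed

lemma Supp_super_schur:
  assumes "is_partition lam"
  shows "Supp (super_schur k l lam)
    = (\<lambda>T. Poly_Mapping.map real (content (k + l) lam T)) ` SSYT k l lam"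
  by (simp add: Supp_def super_schur_eq keys_sum_single_one finite_SSYT assms image_image)

lemma lookup_map_real: "Poly_Mapping.lookup (Poly_Mapping.map real f) i = real (Poly_Mapping.lookup f i)"
  by (simp add: map.rep_eq when_def)

lemma lookup_scaleR: "Poly_Mapping.lookup (u *\<^sub>R f) i = u * Poly_Mapping.lookup f i"
  for f :: "'a \<Rightarrow>\<^sub>0 real"
proof -
  have "finite {i. u *\<^sub>R Poly_Mapping.lookup f i \<noteq> 0}"
    by (rule finite_subset[of _ "Poly_Mapping.keys f"]) (auto simp: in_keys_iff)
  then show ?thesis by (simp add: scaleR_poly_mapping_def)
qed

definition coord_sum :: "nat set \<Rightarrow> (nat \<Rightarrow>\<^sub>0 real) \<Rightarrow> real" where
  "coord_sum S p = (\<Sum>i\<in>S. Poly_Mapping.lookup p i)"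

lemma linear_coord_sum: "linear (coord_sum S)"
  by (rule linearI) (simp_all add: coord_sum_def lookup_add lookup_scaleR sum.distrib sum_distrib_left)

lemma coord_sum_le_hull:
  assumes "p \<in> convex hull X" "\<And>x. x \<in> X \<Longrightarrow> coord_sum S x \<le> c"
  shows "coord_sum S p \<le> c"
proof -
  have "convex (coord_sum S -` {..c})"
    by (rule convex_linear_vimage[OF linear_coord_sum]) (rule convex_real_interval)
  then have "convex hull X \<subseteq> coord_sum S -` {..c}" using assms(2) by (intro hull_minimal) auto
  then show ?thesis using assms(1) by auto
qed

lemma coord_sum_ge_hull:
  assumes "p \<in> convex hull X" "\<And>x. x \<in> X \<Longrightarrow> coord_sum S x \<ge> c"
  shows "coord_sum S p \<ge> c"
proof -
  have "convex (coord_sum S -` {c..})"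
    by (rule convex_linear_vimage[OF linear_coord_sum]) (rule convex_real_interval)
  then have "convex hull X \<subseteq> coord_sum S -` {c..}" using assms(2) by (intro hull_minimal) auto
  then show ?thesis using assms(1) by auto
qed

theorem theorem3p5:
  fixes k l :: nat and lam :: "nat \<Rightarrow> nat"
  assumes "k \<ge> 1" and "l \<ge> 1"
    and "lam \<in> hook k l"
  shows "saturated_Newton_polytope (k + l) (super_schur k l lam)"
proof -
  have lam: "is_partition lam" using assms(3) by (simp add: hook_def)
  then have anti: "antimono lam" and "finite {r. lam r \<noteq> 0}" by (simp_all add: is_partition_def)
  then obtain m where m: "{r. lam r \<noteq> 0} \<subseteq> {..<m}" by (metis finite_nat_iff_bounded)
  define n where "n = max m k"
  have zero: "lam r = 0" if "r \<ge> n" for r using m that by (force simp: n_def)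
  have kn: "k \<le> n" by (simp add: n_def)
  let ?X = "Supp (super_schur k l lam)"
  let ?pt = "\<lambda>T. Poly_Mapping.map real (content (k + l) lam T)"
  have X: "?X = ?pt ` SSYT k l lam" using lam by (rule Supp_super_schur)
  have coord: "coord_sum S (?pt T) = real (\<Sum>v\<in>S. multiplicity_in lam T v)"
    if "S \<subseteq> {..<k + l}" for S T
    using that unfolding coord_sum_def of_nat_sum
    by (intro sum.cong) (auto simp: lookup_map_real lookup_content)
  show ?thesis
    unfolding saturated_Newton_polytope_def
  proof (intro equalityI subsetI)
    fix p assume "p \<in> ?X"
    then obtain T where T: "p = ?pt T" unfolding X by blast
    have "p \<in> Newton (super_schur k l lam)"
      unfolding Newton_def using \<open>p \<in> ?X\<close> by (rule hull_inc)
    moreover have "p \<in> integer_lattice (k + l)"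
      by (auto simp: integer_lattice_def T lookup_map_real lookup_content in_keys_iff split: if_splits)
    ultimately show "p \<in> Newton (super_schur k l lam) \<inter> integer_lattice (k + l)" by blast
  next
    fix p assume "p \<in> Newton (super_schur k l lam) \<inter> integer_lattice (k + l)"
    then have hull: "p \<in> convex hull ?X" and supp: "Poly_Mapping.keys p \<subseteq> {..<k + l}"
      and int: "\<And>i. i < k + l \<Longrightarrow> Poly_Mapping.lookup p i \<in> \<int>"
      by (auto simp: Newton_def integer_lattice_def)
    \<comment> \<open>A lattice point of the polytope has natural coordinates, since the contents are nonnegative.\<close>
    define f where "f i = nat \<lfloor>Poly_Mapping.lookup p i\<rfloor>" for i
    have f: "Poly_Mapping.lookup p i = real (f i)" if "i < k + l" for i
    proof -
      have "coord_sum {i} p \<ge> 0"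
        using hull by (rule coord_sum_ge_hull) (use that in \<open>auto simp: X coord\<close>)
      then show ?thesis using int[OF that] by (auto simp: coord_sum_def f_def elim!: Ints_cases)
    qed
    have sum_f: "coord_sum S p = real (sum f S)" if "S \<subseteq> {..<k + l}" for S
      using that f unfolding coord_sum_def of_nat_sum by (intro sum.cong) auto
    have "sum f S \<le> card (young_diagram lam \<inter> hook_cells (card (S \<inter> {..<k})) (card (S - {..<k})))"
      (is "_ \<le> ?c") if "S \<subseteq> {..<k + l}" for S
    proof -
      have "coord_sum S p \<le> real ?c"
        using hull
      proof (rule coord_sum_le_hull)
        fix x assume "x \<in> ?X"
        then obtain T where T: "T \<in> SSYT k l lam" "x = ?pt T" unfolding X by blast
        then show "coord_sum S x \<le> real ?c"
          using sum_multiplicity_in_le_hook_cells[OF T(1) lam that] by (simp only: coord[OF that] of_nat_le_iff)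
      qed
      then show ?thesis unfolding sum_f[OF that] of_nat_le_iff .
    qed
    moreover have "sum f {..<k + l} = card (young_diagram lam)" (is "_ = ?c")
    proof -
      have "coord_sum {..<k + l} x = real ?c" if "x \<in> ?X" for x
        using that sum_multiplicity_in_all[OF _ lam, of _ k l] unfolding X by (auto simp only: coord)
      then have "coord_sum {..<k + l} p = real ?c"
        using coord_sum_le_hull[OF hull, of "{..<k + l}" "real ?c"]
          coord_sum_ge_hull[OF hull, of "real ?c" "{..<k + l}"] by (simp add: order_antisym)
      then show ?thesis unfolding sum_f[OF order_refl] of_nat_eq_iff .
    qed
    ultimately obtain T where T: "T \<in> SSYT k l lam" "\<forall>v<k + l. multiplicity_in lam T v = f v"
      using exists_SSYT_with_content[OF anti zero kn, of l f] by blast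
    have "p = ?pt T"
    proof (rule poly_mapping_eqI)
      fix i
      show "Poly_Mapping.lookup p i = Poly_Mapping.lookup (?pt T) i"
        using f[of i] T(2) supp by (auto simp: lookup_map_real lookup_content in_keys_iff)
    qed
    then show "p \<in> ?X" unfolding X using T(1) by blast
  qed
qed

end
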